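(* Let $\alpha,\beta,\gamma\in[0,1]$ with $\alpha+\beta>0$ and $\alpha+\gamma>0$. For each $N\geq 1$ let $k^\star=k^\star_N\in\{1,\dots,N\}$ be the integer $k$ with $H_{k-1,N}\ge\frac{\alpha+\gamma}{\alpha+\beta}>H_{k,N}$, and let $\tau^\star=\tau^\star_N$ be the strategy that rejects the first $k^\star-1$ applicants and then accepts the first candidate thereafter. Then, as $N\to\infty$, $$t^\star:=\lim_{N\to\infty}\frac{k^\star}{N}=\exp\Big(-\frac{\alpha+\gamma}{\alpha+\beta}\Big),$$ $$\lim_{N\to\infty}\Big[\frac{k^\star-1}{N}\big((\alpha+\beta)H_{k^\star,N}+\beta-\gamma\big)-\beta\Big]=(\alpha+\beta)\exp\Big(-\frac{\alpha+\gamma}{\alpha+\beta}\Big)-\beta,$$ and the probability that the best applicant is chosen satisfies $$\lim_{N\to\infty}\mathbf P\big(Z_{\tau^\star}=1,\ \tau^\star\le N\big)=\frac{\alpha+\gamma}{\alpha+\beta}\exp\Big(-\frac{\alpha+\gamma}{\alpha+\beta}\Big).$$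
   Context: $N$ applicants appear in an order given by a uniformly random permutation $(\ell_1,\dots,\ell_N)$ of $\{1,\dots,N\}$. $Z_k=\#\{1\le j\le N:\ell_j\le\ell_k\}$ is the absolute rank and $Y_k=\#\{1\le j\le k:\ell_j\le\ell_k\}$ the relative rank of the $k$-th applicant; the $k$-th applicant is a candidate if $Y_k=1$. Thus $\tau^\star=\inf\{k: k^\star\le k\le N,\ Y_k=1\}$ with $\inf\emptyset=\partial$, where $\partial$ means that nobody is chosen and $\{\tau^\star\le N\}=\{\tau^\star\ne\partial\}$. Notation: $H_{k,N}=\sum_{j=k}^{N-1}\frac1j$ for $1\le k\le N$ (so $H_{N,N}=0$) and $H_{0,N}=+\infty$. *)

theory Defs
  imports "HOL-Probability.Probability" "HOL-Combinatorics.Permutations"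
begin

text \<open>
  A permutation is a function \<open>l\<close> with \<open>l permutes {1..N}\<close>; the value \<open>l k\<close> is the
  entry $\ell_k$ belonging to the \<open>k\<close>-th applicant, counted from 1.
\<close>

definition random_order :: "nat \<Rightarrow> (nat \<Rightarrow> nat) pmf" where
  "random_order N = pmf_of_set {l. l permutes {1..N}}"

definition abs_rank :: "nat \<Rightarrow> (nat \<Rightarrow> nat) \<Rightarrow> nat \<Rightarrow> nat" where
  "abs_rank N l k = card {j. 1 \<le> j \<and> j \<le> N \<and> l j \<le> l k}"

definition rel_rank :: "(nat \<Rightarrow> nat) \<Rightarrow> nat \<Rightarrow> nat" where
  "rel_rank l k = card {j. 1 \<le> j \<and> j \<le> k \<and> l j \<le> l k}"

text \<open>
  The time at which the strategy accepts that rejects the first \<open>k - 1\<close> applicants and then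
  takes the first candidate. The value \<open>\<infinity> = Inf {}\<close> plays the role of $\partial$:
  nobody is chosen.
\<close>

definition accept_time :: "nat \<Rightarrow> nat \<Rightarrow> (nat \<Rightarrow> nat) \<Rightarrow> enat" where
  "accept_time N k l = Inf {enat j | j. k \<le> j \<and> j \<le> N \<and> rel_rank l j = 1}"

definition H :: "nat \<Rightarrow> nat \<Rightarrow> ereal" where
  "H k N = (if k = 0 then \<infinity> else ereal (\<Sum>j=k..<N. 1 / real j))"

definition is_threshold :: "real \<Rightarrow> nat \<Rightarrow> nat \<Rightarrow> bool" where
  "is_threshold c N k \<longleftrightarrow> k \<in> {1..N} \<and> H (k - 1) N \<ge> ereal c \<and> ereal c > H k N"

definition kstar :: "real \<Rightarrow> nat \<Rightarrow> nat" where
  "kstar c N = (THE k. is_threshold c N k)"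

lemma H_antimono: "i \<le> k \<Longrightarrow> H k N \<le> H i N"
  by (auto simp: H_def intro!: sum_mono2)

lemma ex1_threshold:
  assumes "c > 0" "N \<ge> 1"
  shows "\<exists>!k. is_threshold c N k"
proof (rule ex_ex1I)
  define k where "k = (LEAST k. H k N < ereal c)"
  have N: "H N N < ereal c"
    using assms by (simp add: H_def)
  have k: "H k N < ereal c"
    unfolding k_def by (rule LeastI[of "\<lambda>k. H k N < ereal c", OF N])
  have "k \<le> N"
    unfolding k_def by (rule Least_le[of "\<lambda>k. H k N < ereal c", OF N])
  moreover have "k \<noteq> 0"
    using k by (cases "k = 0") (simp_all add: H_def)
  moreover from this have "\<not> H (k - 1) N < ereal c"
    using not_less_Least[of "k - 1" "\<lambda>k. H k N < ereal c"] unfolding k_def by simp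
  ultimately show "\<exists>k. is_threshold c N k"
    using k by (auto simp: is_threshold_def not_less intro!: exI[of _ k])
next
  have le: "k \<le> i" if "is_threshold c N k" "is_threshold c N i" for k i
  proof (rule ccontr)
    assume "\<not> k \<le> i"
    then have "H (k - 1) N \<le> H i N"
      by (intro H_antimono) simp
    with that show False
      by (auto simp: is_threshold_def)
  qed
  fix k i
  assume "is_threshold c N k" "is_threshold c N i"
  then show "k = i"
    using le by (intro antisym) blast+
qed

lemma is_threshold_kstar: "c > 0 \<Longrightarrow> N \<ge> 1 \<Longrightarrow> is_threshold c N (kstar c N)"
  unfolding kstar_def by (rule theI'[OF ex1_threshold])

end

theory Submission
  imports Defs "HOL-Real_Asymp.Real_Asymp"
begin

text \<open>
  Comparing the harmonic sum with the logarithm squeezes $k^\star$ between $N e^{-c}$ and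
  $N e^{-c} + 2$, where $c = (\alpha+\gamma)/(\alpha+\beta)$, and the defining property of
  $k^\star$ then forces $H_{k^\star,N} \to c$. The strategy chooses the best applicant iff, for
  some $j \ge k^\star$, that applicant comes at time $j$ and the best of the first $j-1$ comes
  before time $k^\star$. Exchangeability gives this event the probability
  $\frac1N \cdot \frac{k^\star-1}{j-1}$, and summing over $j$ yields
  $\frac{k^\star-1}{N} H_{k^\star-1,N}$.
\<close>

section \<open>Harmonic sums against the logarithm\<close>

lemma sum_inverse_ge_ln:
  assumes "1 \<le> k" "k \<le> N"
  shows "ln (real N / real k) \<le> (\<Sum>j=k..<N. 1 / real j)"
  using assms(2)
proof (induction N rule: dec_induct)
  case base
  then show ?case using assms by simp
next
  case (step n)
  have n: "n > 0" using step assms by simp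
  have "ln (real (Suc n) / real k) = ln (real n / real k) + ln (1 + 1 / real n)"
    using n assms by (simp add: ln_div ln_mult[symmetric] field_simps flip: ln_mult)
  also have "ln (1 + 1 / real n) \<le> 1 / real n"
    using n by (intro ln_add_one_self_le_self) simp
  finally show ?case using step by simp
qed

text \<open>Each \<open>1 / j\<close> is at most the increment of \<open>ln\<close> from
  \<open>j - 1\<close> to \<open>j\<close>, and these increments telescope. The shifted range is
  essential: the unshifted sum lies above the same logarithm.\<close>

lemma sum_inverse_le_ln:
  assumes "1 \<le> k" "k \<le> N"
  shows "(\<Sum>j=Suc k..<Suc N. 1 / real j) \<le> ln (real N / real k)"
  using assms(2)
proof (induction N rule: dec_induct)
  case base
  then show ?case using assms by simp
next
  case (step n)
  have n: "n > 0" using step assms by simp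
  have "ln (real n / real (Suc n)) \<le> real n / real (Suc n) - 1"
    using n by (intro ln_le_minus_one) simp
  also have "\<dots> = - (1 / real (Suc n))" by (simp add: field_simps)
  finally have "1 / real (Suc n) \<le> ln (real (Suc n)) - ln (real n)"
    using n by (simp add: ln_div)
  then show ?case using step n assms by (simp add: ln_div)
qed

section \<open>Asymptotics of the threshold\<close>

text \<open>Each half of the threshold condition meets one logarithmic bound. The 2 collects two
  shifts by one: from \<open>k\<close> to \<open>k - 1\<close> in the condition, and the index shift
  in the upper bound.\<close>

lemma threshold_bounds:
  assumes "is_threshold c N k"
  shows "real N * exp (- c) < real k" "real k \<le> real N * exp (- c) + 2"
proof -
  have k: "1 \<le> k" "k \<le> N" and up: "c > (\<Sum>j=k..<N. 1 / real j)"
    using assms by (auto simp: is_threshold_def H_def)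
  have "ln (real N / real k) < c"
    using sum_inverse_ge_ln[OF k] up by linarith
  then have "real N / real k < exp c"
    using k by (metis exp_less_cancel_iff exp_ln divide_pos_pos of_nat_0_less_iff less_le_trans
        zero_less_one)
  then show "real N * exp (- c) < real k"
    using k by (simp add: exp_minus field_simps)
  show "real k \<le> real N * exp (- c) + 2"
  \<comment> \<open>The upper bound is taken at \<open>k - 2\<close>, which must be positive. For
    smaller \<open>k\<close>, including the case where \<open>H (k - 1) N\<close> is infinite, the
    constant 2 suffices alone.\<close>
  proof (cases "k \<le> 2")
    case True
    then have "real k \<le> 2" by simp
    also have "\<dots> \<le> real N * exp (- c) + 2" by simp
    finally show ?thesis .
  next
    case False
    then have "c \<le> (\<Sum>j=k-1..<N. 1 / real j)"
      using assms by (auto simp: is_threshold_def H_def)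
    also have "\<dots> = (\<Sum>j=Suc (k-2)..<Suc (N-1). 1 / real j)"
      using False k by (intro sum.cong) auto
    also have "\<dots> \<le> ln (real (N-1) / real (k-2))"
      using False k by (intro sum_inverse_le_ln) auto
    finally have "exp c \<le> real (N-1) / real (k-2)"
      using False k by (subst ln_ge_iff[symmetric]) auto
    then have "real (k-2) \<le> real (N-1) * exp (- c)"
      using False k by (simp add: exp_minus field_simps)
    also have "\<dots> \<le> real N * exp (- c)" by simp
    finally show ?thesis using False by simp
  qed
qed

lemma kstar_ratio_tendsto:
  assumes "c > 0"
  shows "(\<lambda>N. real (kstar c N) / real N) \<longlonglongrightarrow> exp (- c)"
proof (rule tendsto_sandwich)
  show "\<forall>\<^sub>F N in sequentially. exp (- c) \<le> real (kstar c N) / real N"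
    using eventually_ge_at_top[of 1]
  proof eventually_elim
    case (elim N)
    then show ?case
      using threshold_bounds(1)[OF is_threshold_kstar[OF assms elim]] by (simp add: field_simps)
  qed
  show "\<forall>\<^sub>F N in sequentially. real (kstar c N) / real N \<le> exp (- c) + 2 / real N"
    using eventually_ge_at_top[of 1]
  proof eventually_elim
    case (elim N)
    then show ?case
      using threshold_bounds(2)[OF is_threshold_kstar[OF assms elim]] by (simp add: field_simps)
  qed
  show "(\<lambda>N. exp (- c) + 2 / real N) \<longlonglongrightarrow> exp (- c)"
    using tendsto_add[OF tendsto_const lim_const_over_n[of 2]] by simp
qed auto

lemma kstar_at_top:
  assumes "c > 0"
  shows "filterlim (kstar c) at_top sequentially"
proof -
  have "filterlim (\<lambda>N. exp (- c) * real N) at_top sequentially"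
    by (rule filterlim_tendsto_pos_mult_at_top[OF tendsto_const _ filterlim_real_sequentially]) simp
  then have "filterlim (\<lambda>N. real (kstar c N)) at_top sequentially"
  proof (rule filterlim_at_top_mono)
    show "\<forall>\<^sub>F N in sequentially. exp (- c) * real N \<le> real (kstar c N)"
      using eventually_ge_at_top[of 1]
    proof eventually_elim
      case (elim N)
      then show ?case
        using threshold_bounds(1)[OF is_threshold_kstar[OF assms elim]] by (simp add: mult.commute)
    qed
  qed
  then show ?thesis by (simp add: filterlim_sequentially_iff_filterlim_real)
qed

text \<open>By the choice of the threshold the two sums enclose \<open>c\<close>, and they differ by
  the single term \<open>1 / (kstar c N - 1)\<close>, which vanishes since the threshold
  diverges.\<close>

lemma sum_inverse_kstar_tendsto:
  assumes "c > 0"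
  shows "(\<lambda>N. \<Sum>j=kstar c N - 1..<N. 1 / real j) \<longlonglongrightarrow> c" (is "?h \<longlonglongrightarrow> c")
    and "(\<lambda>N. \<Sum>j=kstar c N..<N. 1 / real j) \<longlonglongrightarrow> c" (is "?g \<longlonglongrightarrow> c")
proof -
  \<comment> \<open>From 2 on, \<open>H (kstar c N - 1) N\<close> is a real sum and not the infinite
    value at index 0.\<close>
  have ev: "\<forall>\<^sub>F N in sequentially. N \<ge> 1 \<and> kstar c N \<ge> 2"
    using eventually_ge_at_top[of 1]
      filterlim_at_top[THEN iffD1, OF kstar_at_top[OF assms], rule_format, of 2]
    by eventually_elim simp
  have bd: "c \<le> ?h N \<and> ?g N < c \<and> ?h N = 1 / (real (kstar c N) - 1) + ?g N"
    if N: "N \<ge> 1 \<and> kstar c N \<ge> 2" for N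
  proof -
    have T: "is_threshold c N (kstar c N)"
      using is_threshold_kstar[OF assms] N by blast
    have "?h N = 1 / real (kstar c N - 1) + (\<Sum>j=Suc (kstar c N - 1)..<N. 1 / real j)"
      using T N by (intro sum.atLeast_Suc_lessThan) (auto simp: is_threshold_def)
    also have "Suc (kstar c N - 1) = kstar c N" using N by simp
    finally have "?h N = 1 / real (kstar c N - 1) + ?g N" .
    then show ?thesis
      using T N by (simp add: is_threshold_def H_def of_nat_diff)
  qed
  have r: "(\<lambda>N. 1 / (real (kstar c N) - 1)) \<longlonglongrightarrow> 0"
  proof -
    have "(\<lambda>n::nat. 1 / (real n - 1)) \<longlonglongrightarrow> 0"
      by real_asymp
    from filterlim_compose[OF this kstar_at_top[OF assms]] show ?thesis .
  qed
  have u: "(\<lambda>N. c + 1 / (real (kstar c N) - 1)) \<longlonglongrightarrow> c"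
    using tendsto_add[OF tendsto_const r, of c] by simp
  have l: "(\<lambda>N. c - 1 / (real (kstar c N) - 1)) \<longlonglongrightarrow> c"
    using tendsto_diff[OF tendsto_const r, of c] by simp
  show "?h \<longlonglongrightarrow> c"
    by (rule tendsto_sandwich[OF _ _ tendsto_const u])
      (use ev in \<open>eventually_elim; use bd in fastforce\<close>)+
  show "?g \<longlonglongrightarrow> c"
    by (rule tendsto_sandwich[OF _ _ l tendsto_const])
      (use ev in \<open>eventually_elim; use bd in fastforce\<close>)+
qed

section \<open>Counting by exchangeability\<close>

text \<open>Swapping two positions of \<open>S\<close> carries the functions minimal at one
  injectively to those minimal at the other, so all these classes have equal size; injectivity on
  \<open>S\<close> makes them partition \<open>P\<close>. A general \<open>P\<close> allows a second
  use after the position of the best applicant has been fixed.\<close>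

lemma card_minimal_at:
  fixes P :: "('a \<Rightarrow> 'b::linorder) set"
  assumes "finite P" "finite S" "a \<in> S"
    and inj: "\<And>f. f \<in> P \<Longrightarrow> inj_on f S"
    and closed: "\<And>f i j. f \<in> P \<Longrightarrow> i \<in> S \<Longrightarrow> j \<in> S \<Longrightarrow> f \<circ> Transposition.transpose i j \<in> P"
  shows "card S * card {f\<in>P. \<forall>i\<in>S. f a \<le> f i} = card P"
proof -
  define B where "B a = {f\<in>P. \<forall>i\<in>S. f a \<le> f i}" for a
  have fin: "finite (B a)" for a using assms unfolding B_def by auto
  have le: "card (B a) \<le> card (B b)" if "a \<in> S" "b \<in> S" for a b
  proof (rule card_inj_on_le)
    show "inj_on (\<lambda>f. f \<circ> Transposition.transpose a b) (B a)"
      by (rule inj_onI) (metis comp_assoc comp_id transpose_comp_involutory)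
    show "(\<lambda>f. f \<circ> Transposition.transpose a b) ` B a \<subseteq> B b"
      using that closed by (auto simp: B_def Transposition.transpose_def)
  qed (rule fin)
  have "P = (\<Union>b\<in>S. B b)"
  proof
    show "P \<subseteq> (\<Union>b\<in>S. B b)"
    proof
      fix f assume f: "f \<in> P"
      have "Min (f ` S) \<in> f ` S" using assms by (intro Min_in) auto
      then obtain b where "b \<in> S" "f b = Min (f ` S)" by auto
      then show "f \<in> (\<Union>b\<in>S. B b)" using f assms by (auto simp: B_def intro!: bexI[of _ b])
    qed
  qed (auto simp: B_def)
  moreover have "card (\<Union>b\<in>S. B b) = (\<Sum>b\<in>S. card (B b))"
  proof (rule card_UN_disjoint)
    show "\<forall>i\<in>S. \<forall>j\<in>S. i \<noteq> j \<longrightarrow> B i \<inter> B j = {}"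
    proof (intro ballI impI equals0I)
      fix i j f assume "i \<in> S" "j \<in> S" "i \<noteq> j" "f \<in> B i \<inter> B j"
      then show False
        using inj[of f] unfolding B_def inj_on_def by (blast intro: antisym)
    qed
  qed (use assms fin in auto)
  moreover have "(\<Sum>b\<in>S. card (B b)) = (\<Sum>b\<in>S. card (B a))"
    using le assms(3) by (intro sum.cong refl antisym) auto
  ultimately show ?thesis by (simp add: B_def)
qed

section \<open>Ranks, candidates and the acceptance time\<close>

text \<open>An index always counts itself, and injectivity excludes ties. Taking
  \<open>n = N\<close> serves the absolute rank, \<open>n = j\<close> the relative rank.\<close>

lemma card_le_eq_1_iff:
  fixes l :: "nat \<Rightarrow> nat"
  assumes "inj_on l {1..n}" "j \<in> {1..n}"
  shows "card {i. 1 \<le> i \<and> i \<le> n \<and> l i \<le> l j} = 1 \<longleftrightarrow> (\<forall>i\<in>{1..n}. l j \<le> l i)"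
proof -
  have j: "j \<in> {i. 1 \<le> i \<and> i \<le> n \<and> l i \<le> l j}" using assms by auto
  have singleton: "card A = 1 \<longleftrightarrow> A = {j}" if "j \<in> A" for A
    using that by (auto simp: card_1_singleton_iff)
  have "card {i. 1 \<le> i \<and> i \<le> n \<and> l i \<le> l j} = 1 \<longleftrightarrow> {i. 1 \<le> i \<and> i \<le> n \<and> l i \<le> l j} = {j}"
    using singleton[OF j] .
  also have "\<dots> \<longleftrightarrow> (\<forall>i\<in>{1..n}. l j \<le> l i)"
  proof
    assume eq: "{i. 1 \<le> i \<and> i \<le> n \<and> l i \<le> l j} = {j}"
    show "\<forall>i\<in>{1..n}. l j \<le> l i"
    proof
      fix i assume "i \<in> {1..n}"
      then show "l j \<le> l i" using eq by (cases "l i \<le> l j") auto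
    qed
  next
    assume "\<forall>i\<in>{1..n}. l j \<le> l i"
    then have "i = j" if "i \<in> {1..n}" "l i \<le> l j" for i
      using inj_onD[OF assms(1) _ that(1) assms(2)] that by (meson antisym)
    then show "{i. 1 \<le> i \<and> i \<le> n \<and> l i \<le> l j} = {j}"
      using j by auto
  qed
  finally show ?thesis .
qed

lemma accept_time_eq_enat_iff:
  "accept_time N k l = enat j \<longleftrightarrow>
     j \<in> {k..N} \<and> rel_rank l j = 1 \<and> (\<forall>i\<in>{k..<j}. rel_rank l i \<noteq> 1)"
proof -
  let ?A = "{enat j | j. k \<le> j \<and> j \<le> N \<and> rel_rank l j = 1}"
  show ?thesis
  proof
    assume eq: "accept_time N k l = enat j"
    have "?A \<noteq> {}"
    proof
      assume "?A = {}"
      then show False using eq unfolding accept_time_def Inf_enat_def by simp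
    qed
    \<comment> \<open>A nonempty set of extended naturals attains its infimum.\<close>
    then have "Inf ?A \<in> ?A" by (metis (no_types, lifting) Inf_enat_def LeastI ex_in_conv)
    moreover have "Inf ?A \<le> enat i" if "enat i \<in> ?A" for i
      using that by (rule Inf_lower)
    ultimately show "j \<in> {k..N} \<and> rel_rank l j = 1 \<and> (\<forall>i\<in>{k..<j}. rel_rank l i \<noteq> 1)"
      using eq unfolding accept_time_def by fastforce
  next
    assume j: "j \<in> {k..N} \<and> rel_rank l j = 1 \<and> (\<forall>i\<in>{k..<j}. rel_rank l i \<noteq> 1)"
    show "accept_time N k l = enat j"
      unfolding accept_time_def
    proof (rule antisym)
      show "Inf ?A \<le> enat j" using j by (intro Inf_lower) auto
      show "enat j \<le> Inf ?A"
      proof (rule Inf_greatest)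
        fix x assume "x \<in> ?A"
        then obtain i where i: "x = enat i" "k \<le> i" "i \<le> N" "rel_rank l i = 1" by auto
        then have "\<not> i < j" using j by auto
        then show "enat j \<le> x" using i by simp
      qed
    qed
  qed
qed

text \<open>The last candidate up to time \<open>n\<close> is the position of the minimum of the
  first \<open>n\<close> values; so no candidate occurs from \<open>k\<close> on exactly when that
  minimum sits before \<open>k\<close>.\<close>

lemma no_candidate_iff:
  assumes inj: "inj_on l {1..n}" and n: "n \<ge> 1" and k: "k \<ge> 1"
  shows "(\<forall>i\<in>{k..n}. rel_rank l i \<noteq> 1) \<longleftrightarrow> (\<exists>a\<in>{1..<k} \<inter> {1..n}. \<forall>i\<in>{1..n}. l a \<le> l i)"
proof -
  have rr: "rel_rank l i = 1 \<longleftrightarrow> (\<forall>m\<in>{1..i}. l i \<le> l m)" if "i \<in> {1..n}" for i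
    unfolding rel_rank_def using that inj_on_subset[OF inj]
    by (intro card_le_eq_1_iff) auto
  show ?thesis
  proof
    assume no: "\<forall>i\<in>{k..n}. rel_rank l i \<noteq> 1"
    have "Min (l ` {1..n}) \<in> l ` {1..n}" using n by (intro Min_in) auto
    then obtain a where a: "a \<in> {1..n}" "l a = Min (l ` {1..n})" by auto
    then have min: "\<forall>i\<in>{1..n}. l a \<le> l i" by simp
    then have "rel_rank l a = 1" using rr a by auto
    then have "a < k" using no a by (meson atLeastAtMost_iff not_le)
    then show "\<exists>a\<in>{1..<k} \<inter> {1..n}. \<forall>i\<in>{1..n}. l a \<le> l i" using a min by (intro bexI[of _ a]) auto
  next
    assume "\<exists>a\<in>{1..<k} \<inter> {1..n}. \<forall>i\<in>{1..n}. l a \<le> l i"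
    then obtain a where a: "a \<in> {1..<k}" "a \<in> {1..n}" "\<forall>i\<in>{1..n}. l a \<le> l i" by auto
    show "\<forall>i\<in>{k..n}. rel_rank l i \<noteq> 1"
    proof (intro ballI notI)
      fix i assume i: "i \<in> {k..n}" "rel_rank l i = 1"
      then have "l i \<le> l a" using rr[of i] a k by auto
      moreover have "l a \<le> l i" using a i k by auto
      ultimately have "i = a" using inj_onD[OF inj, of i a] a i k by simp
      then show False using a i by auto
    qed
  qed
qed

section \<open>The probability of choosing the best applicant\<close>

text \<open>The winning permutations split by the position \<open>j\<close> of the best applicant
  and the position \<open>a\<close> of the best among the first \<open>j - 1\<close>. The bound 2
  matters: for \<open>k = 1\<close> the first applicant is accepted and wins with probability
  \<open>1 / N\<close>, while the right side is 0.\<close>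

lemma prob_best_chosen:
  assumes k: "2 \<le> k" "k \<le> N"
  shows "measure_pmf.prob (random_order N)
      {l. abs_rank N l (the_enat (accept_time N k l)) = 1 \<and> accept_time N k l \<le> enat N}
    = (real k - 1) / real N * (\<Sum>j=k-1..<N. 1 / real j)"
proof -
  define P where "P = {l::nat \<Rightarrow> nat. l permutes {1..N}}"
  define E where "E = {l. abs_rank N l (the_enat (accept_time N k l)) = 1 \<and> accept_time N k l \<le> enat N}"
  define F where "F j = {l\<in>P. \<forall>i\<in>{1..N}. l j \<le> l i}" for j
  define A where "A j a = {l\<in>F j. \<forall>i\<in>{1..j-1}. l a \<le> l i}" for j a
  have fin: "finite P" unfolding P_def by (intro finite_permutations) simp
  have finA: "finite (A j a)" for j a using fin unfolding A_def F_def by simp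
  have inj: "inj_on l S" if "l \<in> P" for l S
    using that unfolding P_def by (auto dest: permutes_inj_on)
  have P_closed: "l \<circ> Transposition.transpose i j \<in> P" if "l \<in> P" "i \<in> {1..N}" "j \<in> {1..N}" for l i j
    using that unfolding P_def by (auto intro!: permutes_compose permutes_swap_id)
  have cardF: "N * card (F j) = card P" if "j \<in> {1..N}" for j
    using card_minimal_at[of P "{1..N}" j] that fin inj P_closed unfolding F_def by simp
  \<comment> \<open>Swaps among positions below \<open>j\<close> leave the overall minimum at
    \<open>j\<close>, so \<open>F j\<close> is again closed under them.\<close>
  have cardA: "(j - 1) * card (A j a) = card (F j)" if j: "j \<in> {k..N}" and a: "a \<in> {1..<k}" for j a
  proof -
    have "card {1..j-1} * card {l\<in>F j. \<forall>i\<in>{1..j-1}. l a \<le> l i} = card (F j)"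
    proof (rule card_minimal_at)
      fix f m n assume f: "f \<in> F j" and mn: "m \<in> {1..j-1}" "n \<in> {1..j-1}"
      have "f \<circ> Transposition.transpose m n \<in> P" using f mn j by (intro P_closed) (auto simp: F_def)
      moreover have "f j \<le> f (Transposition.transpose m n i)" if "i \<in> {1..N}" for i
        using f mn j that by (auto simp: F_def Transposition.transpose_def)
      moreover have "Transposition.transpose m n j = j" using mn by (auto simp: Transposition.transpose_def)
      ultimately show "f \<circ> Transposition.transpose m n \<in> F j" by (simp add: F_def)
    qed (use fin inj j a in \<open>auto simp: F_def\<close>)
    then show ?thesis by (simp add: A_def)
  qed
  have E_iff: "l \<in> E \<longleftrightarrow> (\<exists>j\<in>{k..N}. \<exists>a\<in>{1..<k}. l \<in> A j a)" if l: "l \<in> P" for l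
  proof -
    have ar: "abs_rank N l j = 1 \<longleftrightarrow> (\<forall>i\<in>{1..N}. l j \<le> l i)" if "j \<in> {k..N}" for j
      unfolding abs_rank_def using that k inj[OF l] by (intro card_le_eq_1_iff) auto
    have rr: "rel_rank l j = 1" if "j \<in> {k..N}" "\<forall>i\<in>{1..N}. l j \<le> l i" for j
      unfolding rel_rank_def using that k inj[OF l] by (subst card_le_eq_1_iff) auto
    have nc: "(\<forall>i\<in>{k..<j}. rel_rank l i \<noteq> 1) \<longleftrightarrow> (\<exists>a\<in>{1..<k}. \<forall>i\<in>{1..j-1}. l a \<le> l i)"
      if "j \<in> {k..N}" for j
    proof -
      have eqs: "{k..<j} = {k..j-1}" "{1..<k} \<inter> {1..j-1} = {1..<k}" using that k by auto
      have "j - 1 \<ge> 1" "k \<ge> 1" using that k by auto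
      then show ?thesis
        unfolding eqs(1) by (rule no_candidate_iff[OF inj[OF l], of "j - 1" k, unfolded eqs(2)])
    qed
    \<comment> \<open>The bound by \<open>enat N\<close> excludes the infinite time, so the value of
      \<open>the_enat\<close> there is irrelevant.\<close>
    have "l \<in> E \<longleftrightarrow> (\<exists>j. accept_time N k l = enat j \<and> abs_rank N l j = 1 \<and> j \<le> N)"
      unfolding E_def by (cases "accept_time N k l") auto
    \<comment> \<open>The best applicant overall is automatically a candidate, so the condition on
      its relative rank disappears.\<close>
    also have "\<dots> \<longleftrightarrow> (\<exists>j\<in>{k..N}. abs_rank N l j = 1 \<and> (\<forall>i\<in>{k..<j}. rel_rank l i \<noteq> 1))"
      unfolding Bex_def
    proof (rule arg_cong[of _ _ Ex], rule ext)
      fix j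
      show "(accept_time N k l = enat j \<and> abs_rank N l j = 1 \<and> j \<le> N) \<longleftrightarrow>
        (j \<in> {k..N} \<and> abs_rank N l j = 1 \<and> (\<forall>i\<in>{k..<j}. rel_rank l i \<noteq> 1))"
        using rr[of j] ar[of j] unfolding accept_time_eq_enat_iff
        by (cases "j \<in> {k..N}") auto
    qed
    also have "\<dots> \<longleftrightarrow> (\<exists>j\<in>{k..N}. \<exists>a\<in>{1..<k}. l \<in> A j a)"
      using ar nc l by (auto simp: A_def F_def)
    finally show ?thesis .
  qed
  let ?I = "{k..N} \<times> {1..<k}"
  have "P \<inter> E = (\<Union>(j, a)\<in>?I. A j a)"
    using E_iff by (auto simp: A_def F_def)
  also have "card \<dots> = (\<Sum>p\<in>?I. card (case p of (j, a) \<Rightarrow> A j a))"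
  proof (rule card_UN_disjoint)
    show "\<forall>p\<in>?I. \<forall>q\<in>?I. p \<noteq> q \<longrightarrow> (case p of (j, a) \<Rightarrow> A j a) \<inter> (case q of (j, a) \<Rightarrow> A j a) = {}"
    proof (intro ballI impI equals0I)
      fix p q l assume pq: "p \<in> ?I" "q \<in> ?I" "p \<noteq> q"
        and l: "l \<in> (case p of (j, a) \<Rightarrow> A j a) \<inter> (case q of (j, a) \<Rightarrow> A j a)"
      obtain j a j' a' where p: "p = (j, a)" "q = (j', a')" by fastforce
      have lA: "l \<in> A j a" "l \<in> A j' a'" using l p by auto
      then have "l \<in> P" by (simp add: A_def F_def)
      \<comment> \<open>Positions of a minimum over the same range coincide: \<open>l\<close>
        determines \<open>j\<close>, and then \<open>a\<close>.\<close>
      then have eqI: "x = y" if "l x \<le> l y" "l y \<le> l x" for x y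
        using inj[of l UNIV] that by (auto simp: inj_on_def)
      have "j = j'" using lA pq p k by (intro eqI) (auto simp: A_def F_def)
      moreover from this have "a = a'" using lA pq p k by (intro eqI) (auto simp: A_def F_def)
      ultimately show False using pq p by simp
    qed
  qed (use finA in auto)
  also have "\<dots> = (\<Sum>j\<in>{k..N}. \<Sum>a\<in>{1..<k}. card (A j a))"
    by (simp add: sum.cartesian_product case_prod_unfold)
  finally have "real (card (P \<inter> E)) = (\<Sum>j\<in>{k..N}. \<Sum>a\<in>{1..<k}. real (card (A j a)))"
    by simp
  also have "\<dots> = (\<Sum>j\<in>{k..N}. \<Sum>a\<in>{1..<k}. real (card P) / real N / real (j - 1))"
  proof (intro sum.cong refl)
    fix j a assume ja: "j \<in> {k..N}" "a \<in> {1..<k}"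
    have "N * ((j - 1) * card (A j a)) = card P"
      using cardA[OF ja] cardF[of j] ja k by simp
    then have "real N * (real (j - 1) * real (card (A j a))) = real (card P)"
      by (metis of_nat_mult)
    moreover have "real N > 0" "real (j - 1) > 0" using ja k by auto
    ultimately show "real (card (A j a)) = real (card P) / real N / real (j - 1)"
      by (simp add: field_simps)
  qed
  \<comment> \<open>The summand does not depend on \<open>a\<close>, which has \<open>k - 1\<close>
    choices.\<close>
  also have "\<dots> = real (card P) * ((real k - 1) / real N * (\<Sum>j\<in>{k..N}. 1 / real (j - 1)))"
    using k by (simp add: sum_distrib_left of_nat_diff mult.commute)
  also have "(\<Sum>j\<in>{k..N}. 1 / real (j - 1)) = (\<Sum>j=k-1..<N. 1 / real j)"
    by (rule sum.reindex_bij_witness[of _ Suc "\<lambda>j. j - 1"]) (use k in auto)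
  finally have "real (card (P \<inter> E)) =
    real (card P) * ((real k - 1) / real N * (\<Sum>j=k-1..<N. 1 / real j))" .
  moreover have "P \<noteq> {}" unfolding P_def using permutes_id by blast
  moreover have "measure_pmf.prob (random_order N) E = real (card (P \<inter> E)) / real (card P)"
    unfolding random_order_def P_def[symmetric]
    using fin \<open>P \<noteq> {}\<close> by (rule measure_pmf_of_set[rotated])
  ultimately show ?thesis using fin by (simp add: E_def)
qed

section \<open>The three limits\<close>

theorem corollary2p3:
  fixes \<alpha> \<beta> \<gamma> :: real
  assumes "\<alpha> \<in> {0..1}" "\<beta> \<in> {0..1}" "\<gamma> \<in> {0..1}"
    and "\<alpha> + \<beta> > 0" and "\<alpha> + \<gamma> > 0"
  shows "((\<lambda>N. real (kstar ((\<alpha> + \<gamma>) / (\<alpha> + \<beta>)) N) / real N)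
            \<longlonglongrightarrow> exp (- ((\<alpha> + \<gamma>) / (\<alpha> + \<beta>)))) \<and>
         ((\<lambda>N. (real (kstar ((\<alpha> + \<gamma>) / (\<alpha> + \<beta>)) N) - 1) / real N *
               ((\<alpha> + \<beta>) * real_of_ereal (H (kstar ((\<alpha> + \<gamma>) / (\<alpha> + \<beta>)) N) N) + \<beta> - \<gamma>) - \<beta>)
            \<longlonglongrightarrow> (\<alpha> + \<beta>) * exp (- ((\<alpha> + \<gamma>) / (\<alpha> + \<beta>))) - \<beta>) \<and>
         ((\<lambda>N. measure_pmf.prob (random_order N)
               {l. abs_rank N l (the_enat (accept_time N (kstar ((\<alpha> + \<gamma>) / (\<alpha> + \<beta>)) N) l)) = 1
                   \<and> accept_time N (kstar ((\<alpha> + \<gamma>) / (\<alpha> + \<beta>)) N) l \<le> enat N})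
            \<longlonglongrightarrow> (\<alpha> + \<gamma>) / (\<alpha> + \<beta>) * exp (- ((\<alpha> + \<gamma>) / (\<alpha> + \<beta>))))"
proof -
  define c where "c = (\<alpha> + \<gamma>) / (\<alpha> + \<beta>)"
  have c: "c > 0" and c': "(\<alpha> + \<beta>) * c = \<alpha> + \<gamma>"
    using assms by (auto simp: c_def)
  note t = kstar_ratio_tendsto[OF c]
  have t': "(\<lambda>N. (real (kstar c N) - 1) / real N) \<longlonglongrightarrow> exp (- c)"
    using tendsto_diff[OF t lim_const_over_n[of 1]] by (simp add: diff_divide_distrib)
  have ev: "\<forall>\<^sub>F N in sequentially. 2 \<le> kstar c N \<and> kstar c N \<le> N"
    using eventually_ge_at_top[of 1]
      filterlim_at_top[THEN iffD1, OF kstar_at_top[OF c], rule_format, of 2]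
  proof eventually_elim
    case (elim N)
    then show ?case using is_threshold_kstar[OF c, of N] by (simp add: is_threshold_def)
  qed
  have "(\<lambda>N. (real (kstar c N) - 1) / real N *
      ((\<alpha> + \<beta>) * (\<Sum>j=kstar c N..<N. 1 / real j) + \<beta> - \<gamma>) - \<beta>)
    \<longlonglongrightarrow> exp (- c) * ((\<alpha> + \<beta>) * c + \<beta> - \<gamma>) - \<beta>"
    by (intro tendsto_intros t' sum_inverse_kstar_tendsto(2)[OF c])
  \<comment> \<open>Since \<open>c\<close> is the quotient of \<alpha> + \<gamma> by \<alpha> +
    \<beta>, the terms in \<gamma> cancel.\<close>
  also have "exp (- c) * ((\<alpha> + \<beta>) * c + \<beta> - \<gamma>) - \<beta> = (\<alpha> + \<beta>) * exp (- c) - \<beta>"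
    unfolding c' by simp
  finally have payoff: "(\<lambda>N. (real (kstar c N) - 1) / real N *
      ((\<alpha> + \<beta>) * real_of_ereal (H (kstar c N) N) + \<beta> - \<gamma>) - \<beta>)
    \<longlonglongrightarrow> (\<alpha> + \<beta>) * exp (- c) - \<beta>"
    by (rule Lim_transform_eventually) (use ev in \<open>eventually_elim; simp add: H_def\<close>)
  have "(\<lambda>N. (real (kstar c N) - 1) / real N * (\<Sum>j=kstar c N - 1..<N. 1 / real j))
    \<longlonglongrightarrow> exp (- c) * c"
    by (intro tendsto_intros t' sum_inverse_kstar_tendsto(1)[OF c])
  then have "(\<lambda>N. measure_pmf.prob (random_order N)
      {l. abs_rank N l (the_enat (accept_time N (kstar c N) l)) = 1
        \<and> accept_time N (kstar c N) l \<le> enat N}) \<longlonglongrightarrow> exp (- c) * c"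
    by (rule Lim_transform_eventually) (rule eventually_mono[OF ev], rule prob_best_chosen[symmetric], simp_all)
  then show ?thesis
    using t payoff unfolding c_def[symmetric] by (simp add: mult.commute)
qed

end
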